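(* Let $G$ be a probability distribution function on $[0,\infty)$ with finite mean equal to $1$ and a density $g$, whose hazard rate $h(x)=g(x)/(1-G(x))$ satisfies $\sup_{x\in[0,\infty)} h(x)\le H$ for some constant $H<\infty$, and write $\overline G=1-G$. Let $\lambda$ be a non-negative locally integrable function on $[0,\infty)$ (i.e. $\int_0^T\lambda(t)\,dt<\infty$ for every $T<\infty$), and let $Z^0_\ell\in\mathbb{C}^1_{\le 1}[0,\infty)$ for every $\ell\ge1$. Then the hydrodynamic PDE associated to $(\lambda, Z^0_\ell;\ell\ge1)$ has at most one solution $(Z_\ell;\ell\ge1)$ with $Z_\ell\in\mathbb{X}$ for all $\ell\ge1$.
   Context: $\mathbb{C}^1_{\le 1}[0,\infty)$ denotes the space of continuously differentiable functions $f$ on $[0,\infty)$ with bounded derivative and $|f|\le 1$. $\mathbb{X}$ denotes the set of functions $\varphi$ on $[0,\infty)\times[0,\infty)$ such that for every $t\ge0$, $\varphi(t,\cdot)\in\mathbb{C}^1_{\le1}[0,\infty)$, and for every $r\ge0$ the map $t\mapsto\varphi(t,r)$ is measurable; $\partial_r\varphi$ denotes the derivative in the second variable. A family $(Z_\ell;\ell\ge1)$ with $Z_\ell\in\mathbb{X}$ solves the hydrodynamic PDE associated to $(\lambda,Z^0_\ell;\ell\ge1)$ if for all $t,r\ge0$: $Z_1(t,r)=Z_1^0(t+r)-\int_0^t\overline G(t+r-u)\partial_rZ_2(u,0)\,du+\int_0^t\lambda(u)\overline G(t+r-u)(1-Z_1(u,0)^2)\,du$, $Z_1(t,0)=Z_1^0(0)+\int_0^t(\partial_rZ_1(u,0)-\partial_rZ_2(u,0))\,du+\int_0^t\lambda(u)(1-Z_1(u,0)^2)\,du$,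 and for every $\ell\ge2$: $Z_\ell(t,r)=Z_\ell^0(t+r)-\int_0^t\overline G(t+r-u)\partial_rZ_{\ell+1}(u,0)\,du+\int_0^t\lambda(u)(Z_{\ell-1}(u,0)+Z_\ell(u,0))(Z_{\ell-1}(u,t+r-u)-Z_\ell(u,t+r-u))\,du$, $Z_\ell(t,0)=Z_\ell^0(0)+\int_0^t(\partial_rZ_\ell(u,0)-\partial_rZ_{\ell+1}(u,0))\,du+\int_0^t\lambda(u)(Z_{\ell-1}(u,0)^2-Z_\ell(u,0)^2)\,du$. *)

theory Defs
  imports "HOL-Analysis.Analysis"
begin

definition C1le1 :: "(real \<Rightarrow> real) \<Rightarrow> bool" where
  "C1le1 f \<longleftrightarrow>
     (\<exists>f'. (\<forall>x\<in>{0..}. (f has_real_derivative f' x) (at x within {0..}))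
         \<and> continuous_on {0..} f'
         \<and> (\<exists>B. \<forall>x\<in>{0..}. \<bar>f' x\<bar> \<le> B))
     \<and> (\<forall>x\<in>{0..}. \<bar>f x\<bar> \<le> 1)"

definition inX :: "(real \<Rightarrow> real \<Rightarrow> real) \<Rightarrow> bool" where
  "inX \<phi> \<longleftrightarrow> (\<forall>t\<ge>0. C1le1 (\<phi> t))
             \<and> (\<forall>r\<ge>0. set_borel_measurable lborel {0..} (\<lambda>t. \<phi> t r))"

definition dr :: "(real \<Rightarrow> real \<Rightarrow> real) \<Rightarrow> real \<Rightarrow> real \<Rightarrow> real" where
  "dr \<phi> t r = (THE D. (\<phi> t has_real_derivative D) (at r within {0..}))"

text \<open>Solution of the hydrodynamic PDE associated to (lam, Z0_l; l>=1), where
  Gbar = 1 - G. Each integral over [0,t] is a Lebesgue integral and its integrand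
  is required to be integrable, so that the equations are meaningful.\<close>
definition hydro_solution ::
  "(real \<Rightarrow> real) \<Rightarrow> (real \<Rightarrow> real) \<Rightarrow> (nat \<Rightarrow> real \<Rightarrow> real)
    \<Rightarrow> (nat \<Rightarrow> real \<Rightarrow> real \<Rightarrow> real) \<Rightarrow> bool" where
  "hydro_solution G lam Z0 Z \<longleftrightarrow>
    (\<forall>t\<ge>0. \<forall>r\<ge>0.
      let Gbar = (\<lambda>x. 1 - G x) in
      set_integrable lborel {0..t} (\<lambda>u. Gbar (t + r - u) * dr (Z 2) u 0)
    \<and> set_integrable lborel {0..t} (\<lambda>u. lam u * Gbar (t + r - u) * (1 - (Z 1 u 0)^2))
    \<and> Z 1 t r = Z0 1 (t + r)
        - (\<integral>u\<in>{0..t}. Gbar (t + r - u) * dr (Z 2) u 0 \<partial>lborel)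
        + (\<integral>u\<in>{0..t}. lam u * Gbar (t + r - u) * (1 - (Z 1 u 0)^2) \<partial>lborel)
    \<and> set_integrable lborel {0..t} (\<lambda>u. dr (Z 1) u 0 - dr (Z 2) u 0)
    \<and> set_integrable lborel {0..t} (\<lambda>u. lam u * (1 - (Z 1 u 0)^2))
    \<and> Z 1 t 0 = Z0 1 0
        + (\<integral>u\<in>{0..t}. dr (Z 1) u 0 - dr (Z 2) u 0 \<partial>lborel)
        + (\<integral>u\<in>{0..t}. lam u * (1 - (Z 1 u 0)^2) \<partial>lborel)
    \<and> (\<forall>l\<ge>2.
         set_integrable lborel {0..t} (\<lambda>u. Gbar (t + r - u) * dr (Z (l + 1)) u 0)
       \<and> set_integrable lborel {0..t} (\<lambda>u. lam u * (Z (l - 1) u 0 + Z l u 0)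
              * (Z (l - 1) u (t + r - u) - Z l u (t + r - u)))
       \<and> Z l t r = Z0 l (t + r)
           - (\<integral>u\<in>{0..t}. Gbar (t + r - u) * dr (Z (l + 1)) u 0 \<partial>lborel)
           + (\<integral>u\<in>{0..t}. lam u * (Z (l - 1) u 0 + Z l u 0)
                * (Z (l - 1) u (t + r - u) - Z l u (t + r - u)) \<partial>lborel)
       \<and> set_integrable lborel {0..t} (\<lambda>u. dr (Z l) u 0 - dr (Z (l + 1)) u 0)
       \<and> set_integrable lborel {0..t} (\<lambda>u. lam u * ((Z (l - 1) u 0)^2 - (Z l u 0)^2))
       \<and> Z l t 0 = Z0 l 0
           + (\<integral>u\<in>{0..t}. dr (Z l) u 0 - dr (Z (l + 1)) u 0 \<partial>lborel)
           + (\<integral>u\<in>{0..t}. lam u * ((Z (l - 1) u 0)^2 - (Z l u 0)^2) \<partial>lborel)))"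

end

theory Submission
  imports Defs
begin

text \<open>
  Let \<open>D\<^sub>l\<close> be the difference of the boundary derivatives of two solutions and
  \<open>A\<^sub>l(t)\<close> its integral over \<open>[0,t]\<close>. Integrating by parts, the first equation expresses
  the difference of the \<open>Z\<^sub>l\<close> through \<open>A\<^sub>l\<^sub>+\<^sub>1\<close> and a \<open>\<lambda>\<close>-integral. This alone is not
  a contraction, but subtracting the boundary equation gives
  \<open>A\<^sub>l = g * A\<^sub>l\<^sub>+\<^sub>1 + \<lambda>\<close>-integrals (convolution), in which no \<open>A\<close> stands outside
  an integral. In the norm weighted by \<open>exp (- K t)\<close>, taken uniformly in \<open>l\<close>, both
  kinds of integrals become arbitrarily small as \<open>K\<close> grows. That the \<open>A\<^sub>l\<close> are bounded
  uniformly in \<open>l\<close> at all follows from the renewal equation satisfied by each single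
  \<open>A\<^sub>l\<^sub>+\<^sub>1\<close>, again by the weighted norm.
\<close>


section \<open>Set integrals against exponential weights\<close>

text \<open>A non-integrable \<open>f\<close> has integral 0 by convention, and the right-hand side
  is non-negative because \<open>h\<close> dominates an absolute value on \<open>S\<close>. The
  estimates below can therefore be read off pointwise, with only the majorant to be shown
  integrable.\<close>

lemma abs_set_integral_le:
  fixes f h :: "'a \<Rightarrow> real"
  assumes h: "set_integrable M S h" and le: "\<And>x. x \<in> S \<Longrightarrow> \<bar>f x\<bar> \<le> h x"
  shows "\<bar>\<integral>x\<in>S. f x \<partial>M\<bar> \<le> (\<integral>x\<in>S. h x \<partial>M)"
proof (cases "set_integrable M S f")
  case True
  have "norm (integral\<^sup>L M (\<lambda>x. indicator S x *\<^sub>R f x)) \<le> integral\<^sup>L M (\<lambda>x. indicator S x *\<^sub>R h x)"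
    using True h le unfolding set_integrable_def
    by (intro order_trans[OF integral_norm_bound] integral_mono integrable_norm)
       (auto simp: indicator_def)
  then show ?thesis
    by (simp add: set_lebesgue_integral_def)
next
  case False
  then have "(\<integral>x\<in>S. f x \<partial>M) = 0"
    by (simp add: set_lebesgue_integral_def set_integrable_def not_integrable_integral_eq)
  moreover have "0 \<le> (\<integral>x\<in>S. h x \<partial>M)"
    unfolding set_lebesgue_integral_def
  proof (intro Bochner_Integration.integral_nonneg)
    fix x show "0 \<le> indicator S x *\<^sub>R h x"
      using le[of x] by (cases "x \<in> S") auto
  qed
  ultimately show ?thesis by simp
qed

text \<open>Truncation at height \<open>N\<close>: the part of \<open>p\<close> above \<open>N\<close> contributes at most \<open>e\<close>.\<close>
lemma set_integral_mult_small_weight_le: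
  fixes p :: "'a \<Rightarrow> real"
  assumes p: "set_integrable M S p" and e: "e > 0"
  obtains N :: real where "N > 0"
    "\<And>A w. \<lbrakk>A \<in> sets M; A \<subseteq> S; set_integrable M A w; \<And>x. x \<in> A \<Longrightarrow> 0 \<le> w x \<and> w x \<le> 1;
        \<And>x. x \<in> A \<Longrightarrow> 0 \<le> p x\<rbrakk> \<Longrightarrow> (\<integral>x\<in>A. p x * w x \<partial>M) \<le> e + N * (\<integral>x\<in>A. w x \<partial>M)"
proof -
  let ?s = "\<lambda>(n::nat) x. indicator S x *\<^sub>R max 0 (p x - real n)"
  \<comment> \<open>Only the product of \<open>p\<close> with the indicator is known to be
    measurable. The indicator can be moved inside the maximum because
    \<open>max 0 (0 - real n)\<close> is 0.\<close>
  have eq: "?s n = (\<lambda>x. max 0 (indicator S x *\<^sub>R p x - real n))" for n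
    by (auto simp: indicator_def)
  have sint: "integrable M (\<lambda>x. indicator S x *\<^sub>R p x)"
    using p by (simp add: set_integrable_def)
  then have [measurable]: "(\<lambda>x. indicator S x *\<^sub>R p x) \<in> borel_measurable M"
    by auto
  have smeas: "?s n \<in> borel_measurable M" for n
    unfolding eq by measurable
  have sle: "norm (?s n x) \<le> norm (indicator S x *\<^sub>R p x)" for n x
    by (auto simp: indicator_def)
  have lim0: "(\<lambda>n. ?s n x) \<longlonglongrightarrow> 0" for x
  proof (rule tendsto_eventually)
    obtain m where "p x \<le> real m" using real_arch_simple by blast
    then show "\<forall>\<^sub>F n in sequentially. ?s n x = 0"
      by (auto simp: eventually_sequentially max_def intro!: exI[of _ m])
  qed
  have "(\<lambda>n. integral\<^sup>L M (?s n)) \<longlonglongrightarrow> integral\<^sup>L M (\<lambda>x. 0)"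
    by (rule integral_dominated_convergence[where w="\<lambda>x. norm (indicator S x *\<^sub>R p x)"])
       (use smeas sle lim0 integrable_norm[OF sint] in \<open>auto\<close>)
  then have "\<forall>\<^sub>F n in sequentially. integral\<^sup>L M (?s n) < e"
    using e by (auto intro: order_tendstoD)
  then obtain n where n: "integral\<^sup>L M (?s n) < e"
    by (auto simp: eventually_sequentially)
  have qint: "set_integrable M S (\<lambda>x. max 0 (p x - real n))"
    unfolding set_integrable_def
    by (rule Bochner_Integration.integrable_bound[OF sint smeas]) (use sle in auto)
  show ?thesis
  \<comment> \<open>The summand 1 keeps the constant positive when \<open>n = 0\<close>.\<close>
  proof (rule that[of "real n + 1"])
    fix A and w :: "'a \<Rightarrow> real"
    assume A: "A \<in> sets M" "A \<subseteq> S" and w: "set_integrable M A w"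
      and w01: "\<And>x. x \<in> A \<Longrightarrow> 0 \<le> w x \<and> w x \<le> 1" and p0: "\<And>x. x \<in> A \<Longrightarrow> 0 \<le> p x"
    have qA: "set_integrable M A (\<lambda>x. max 0 (p x - real n))"
      using set_integrable_subset[OF qint A] .
    have "\<bar>\<integral>x\<in>A. p x * w x \<partial>M\<bar> \<le> (\<integral>x\<in>A. max 0 (p x - real n) + (real n + 1) * w x \<partial>M)"
    proof (rule abs_set_integral_le)
      show "set_integrable M A (\<lambda>x. max 0 (p x - real n) + (real n + 1) * w x)"
        using qA w by simp
      fix x assume x: "x \<in> A"
      \<comment> \<open>On the excess above \<open>n\<close> the weight is replaced by its bound 1;
        on the bounded part it is kept.\<close>
      have "p x * w x \<le> (max 0 (p x - real n) + real n) * w x"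
        using w01[OF x] by (intro mult_right_mono) auto
      also have "\<dots> = max 0 (p x - real n) * w x + real n * w x"
        by (simp add: algebra_simps)
      also have "\<dots> \<le> max 0 (p x - real n) * 1 + (real n + 1) * w x"
        using w01[OF x] by (intro add_mono mult_left_mono mult_right_mono) auto
      finally show "\<bar>p x * w x\<bar> \<le> max 0 (p x - real n) + (real n + 1) * w x"
        using w01[OF x] p0[OF x] by simp
    qed
    also have "\<dots> = (\<integral>x\<in>A. max 0 (p x - real n) \<partial>M) + (real n + 1) * (\<integral>x\<in>A. w x \<partial>M)"
      using qA w by simp
    also have "(\<integral>x\<in>A. max 0 (p x - real n) \<partial>M) \<le> integral\<^sup>L M (?s n)"
      using qA qint A unfolding set_lebesgue_integral_def set_integrable_def
      by (intro integral_mono) (auto simp: indicator_def)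
    finally show "(\<integral>x\<in>A. p x * w x \<partial>M) \<le> e + (real n + 1) * (\<integral>x\<in>A. w x \<partial>M)"
      using n by linarith
  qed simp
qed

lemma set_integral_exp_weights_le:
  fixes K t :: real
  assumes "K > 0" "t \<ge> 0"
  shows "(\<integral>u\<in>{0..t}. exp (- K * u) \<partial>lborel) \<le> 1 / K"
    and "(\<integral>u\<in>{0..t}. exp (- K * (t - u)) \<partial>lborel) \<le> 1 / K"
proof -
  have "(\<integral>u. indicator {0..t} u *\<^sub>R exp (- K * u) \<partial>lborel) = - exp (- K * t) / K - (- exp (- K * 0) / K)"
    using assms by (intro integral_FTC_atLeastAtMost)
      (auto intro!: derivative_eq_intros continuous_intros
        simp: has_real_derivative_iff_has_vector_derivative[symmetric])
  then show "(\<integral>u\<in>{0..t}. exp (- K * u) \<partial>lborel) \<le> 1 / K"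
    using assms by (simp add: set_lebesgue_integral_def divide_right_mono)
  have "(\<integral>u. indicator {0..t} u *\<^sub>R exp (- K * (t - u)) \<partial>lborel) = exp (- K * (t - t)) / K - exp (- K * (t - 0)) / K"
    using assms by (intro integral_FTC_atLeastAtMost)
      (auto intro!: derivative_eq_intros continuous_intros
        simp: has_real_derivative_iff_has_vector_derivative[symmetric])
  then show "(\<integral>u\<in>{0..t}. exp (- K * (t - u)) \<partial>lborel) \<le> 1 / K"
    using assms by (simp add: set_lebesgue_integral_def divide_right_mono)
qed

text \<open>Truncating \<open>p\<close> leaves an error of \<open>e / 2\<close> and a bounded part,
  which meets a weight of total mass at most \<open>1 / K\<close>. One threshold serves all
  \<open>t\<close> up to \<open>T\<close>. The weight decaying from 0 is for the convolution with
  \<open>g\<close>, the one decaying backwards from \<open>t\<close> for the integrals against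
  \<open>lam\<close>.\<close>

lemma set_integral_exp_damped_small:
  fixes p :: "real \<Rightarrow> real"
  assumes p: "set_integrable lborel {0..T} p" and p0: "\<And>x. x \<ge> 0 \<Longrightarrow> p x \<ge> 0" and e: "e > 0"
  obtains K0 where "K0 > 0"
    "\<And>K t. \<lbrakk>K \<ge> K0; 0 \<le> t; t \<le> T\<rbrakk> \<Longrightarrow> (\<integral>u\<in>{0..t}. p u * exp (- K * u) \<partial>lborel) \<le> e"
    "\<And>K t. \<lbrakk>K \<ge> K0; 0 \<le> t; t \<le> T\<rbrakk> \<Longrightarrow> (\<integral>u\<in>{0..t}. p u * exp (- K * (t - u)) \<partial>lborel) \<le> e"
proof -
  have e2: "e / 2 > 0" using e by simp
  obtain N where N: "N > 0"
    "\<And>A w. \<lbrakk>A \<in> sets lborel; A \<subseteq> {0..T}; set_integrable lborel A w; \<And>x. x \<in> A \<Longrightarrow> 0 \<le> w x \<and> w x \<le> 1;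
        \<And>x. x \<in> A \<Longrightarrow> 0 \<le> p x\<rbrakk> \<Longrightarrow> (\<integral>x\<in>A. p x * w x \<partial>lborel) \<le> e / 2 + N * (\<integral>x\<in>A. w x \<partial>lborel)"
    using set_integral_mult_small_weight_le[OF p e2] by blast
  \<comment> \<open>The threshold \<open>2 * N / e\<close> is exactly what makes
    \<open>N / K\<close> at most \<open>e / 2\<close>.\<close>
  have small: "(\<integral>u\<in>{0..t}. p u * w u \<partial>lborel) \<le> e"
    if K: "K \<ge> 2 * N / e" and t: "0 \<le> t" "t \<le> T" and c: "continuous_on {0..t} w"
      and w: "\<And>x. x \<in> {0..t} \<Longrightarrow> 0 \<le> w x \<and> w x \<le> 1" and i: "(\<integral>u\<in>{0..t}. w u \<partial>lborel) \<le> 1 / K"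
    for K t and w :: "real \<Rightarrow> real"
  proof -
    have "K > 0" using K N(1) e by (smt (verit) divide_pos_pos)
    have "(\<integral>u\<in>{0..t}. p u * w u \<partial>lborel) \<le> e / 2 + N * (\<integral>u\<in>{0..t}. w u \<partial>lborel)"
      using t w p0 by (intro N(2) borel_integrable_atLeastAtMost' c) auto
    also have "\<dots> \<le> e / 2 + N * (1 / K)"
      using i N(1) by (intro add_left_mono mult_left_mono) auto
    also have "N * (1 / K) \<le> e / 2"
      using K \<open>K > 0\<close> e by (simp add: field_simps)
    finally show ?thesis by simp
  qed
  have pos: "2 * N / e > 0" using N(1) e by simp
  show ?thesis
  proof (rule that[OF pos])
    fix K t assume K: "2 * N / e \<le> K" and t: "0 \<le> t" "t \<le> T"
    have "K > 0" using K pos by linarith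
    then show "(\<integral>u\<in>{0..t}. p u * exp (- K * u) \<partial>lborel) \<le> e"
      and "(\<integral>u\<in>{0..t}. p u * exp (- K * (t - u)) \<partial>lborel) \<le> e"
      using set_integral_exp_weights_le[OF _ t(1)]
      by (auto intro!: small[OF K t] continuous_intros)
  qed
qed

section \<open>Fubini and integration by parts for convolutions\<close>

lemma integrable_lborel_pair_mult:
  fixes f h :: "real \<Rightarrow> real"
  assumes f: "integrable lborel f" and h: "integrable lborel h"
  shows "integrable (lborel \<Otimes>\<^sub>M lborel) (\<lambda>(x, y). f x * h y)"
proof (rule lborel_pair.Fubini_integrable)
  show "(\<lambda>(x, y). f x * h y) \<in> borel_measurable (lborel \<Otimes>\<^sub>M lborel)"
    using borel_measurable_integrable[OF f] borel_measurable_integrable[OF h] by measurable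
  show "integrable lborel (\<lambda>x. \<integral>y. norm (case (x, y) of (x, y) \<Rightarrow> f x * h y) \<partial>lborel)"
    using f by (simp add: abs_mult)
  show "AE x in lborel. integrable lborel (\<lambda>y. case (x, y) of (x, y) \<Rightarrow> f x * h y)"
    using h by simp
qed

text \<open>Integration by parts for the convolution of the density of \<open>G\<close> with the primitive
  of \<open>D\<close>, proved by Fubini since \<open>D\<close> and \<open>g\<close> are merely integrable.\<close>
lemma convolution_by_parts:
  fixes D g G :: "real \<Rightarrow> real"
  assumes D: "set_integrable lborel {0..t} D" and g: "set_integrable lborel {0..} g"
    and G: "\<And>x. x \<ge> 0 \<Longrightarrow> G x = (\<integral>y\<in>{0..x}. g y \<partial>lborel)" and tr: "t \<ge> 0" "r \<ge> 0"
  shows "(\<integral>u\<in>{0..t}. G (t + r - u) * D u \<partial>lborel) =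
    (\<integral>y\<in>{0..t+r}. g y * (\<integral>u\<in>{0..min t (t + r - y)}. D u \<partial>lborel) \<partial>lborel)"
proof -
  let ?f = "\<lambda>u. indicator {0..t} u * D u" and ?h = "\<lambda>y. indicator {0..} y * g y"
  \<comment> \<open>The product \<open>D u * g y\<close> is cut off at
    \<open>u + y \<le> t + r\<close>. Integrating first in \<open>y\<close> gives
    \<open>G (t + r - u)\<close>; integrating first in \<open>u\<close> gives the primitive of
    \<open>D\<close> at \<open>min t (t + r - y)\<close>.\<close>
  let ?F = "\<lambda>u y. ?f u * ?h y * indicator {x. fst x + snd x \<le> t + r} (u, y)"
  have f: "integrable lborel ?f" and h: "integrable lborel ?h"
    using D g by (simp_all add: set_integrable_def)
  have "integrable (lborel \<Otimes>\<^sub>M lborel) (\<lambda>x. (case x of (u, y) \<Rightarrow> ?f u * ?h y) * indicator {x. fst x + snd x \<le> t + r} x)"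
    by (intro integrable_real_mult_indicator integrable_lborel_pair_mult f h, unfold lborel_prod)
       (auto intro!: borel_closed closed_Collect_le continuous_intros)
  then have int: "integrable (lborel \<Otimes>\<^sub>M lborel) (case_prod ?F)"
    by (rule back_subst[where P="integrable _"]) (auto simp: fun_eq_iff)
  have "(\<integral>y. (\<integral>u. ?F u y \<partial>lborel) \<partial>lborel) = (\<integral>u. (\<integral>y. ?F u y \<partial>lborel) \<partial>lborel)"
    by (rule lborel_pair.Fubini_integral[OF int])
  also have "(\<lambda>u. \<integral>y. ?F u y \<partial>lborel) = (\<lambda>u. indicator {0..t} u * (G (t + r - u) * D u))"
  proof
    fix u
    show "(\<integral>y. ?F u y \<partial>lborel) = indicator {0..t} u * (G (t + r - u) * D u)"
    proof (cases "u \<in> {0..t}")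
      case True
      then have "(\<lambda>y. ?F u y) = (\<lambda>y. D u * (indicator {0..t+r-u} y * g y))"
        by (auto simp: indicator_def fun_eq_iff)
      then show ?thesis
        using True tr by (simp add: G set_lebesgue_integral_def)
    qed simp
  qed
  also have "(\<lambda>y. \<integral>u. ?F u y \<partial>lborel) =
    (\<lambda>y. indicator {0..t+r} y * (g y * (\<integral>u\<in>{0..min t (t + r - y)}. D u \<partial>lborel)))"
  proof
    fix y
    show "(\<integral>u. ?F u y \<partial>lborel) = indicator {0..t+r} y * (g y * (\<integral>u\<in>{0..min t (t + r - y)}. D u \<partial>lborel))"
    proof (cases "y \<in> {0..t+r}")
      case True
      then have "(\<lambda>u. ?F u y) = (\<lambda>u. g y * (indicator {0..min t (t+r-y)} u * D u))"
        by (auto simp: indicator_def fun_eq_iff)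
      then show ?thesis
        using True by (simp add: set_lebesgue_integral_def)
    next
      case False
      then have "(\<lambda>u. ?F u y) = (\<lambda>u. 0)"
        by (auto simp: indicator_def fun_eq_iff)
      then show ?thesis using False by simp
    qed
  qed
  finally show ?thesis
    by (simp add: set_lebesgue_integral_def)
qed

section \<open>Passage to the limit, and local integrability without the tail weight\<close>

text \<open>This is how the contractions are concluded: each round halves the surplus of a bound,
  and the limit removes it.\<close>

lemma le_of_le_plus_halving:
  fixes f c x :: real
  assumes "\<And>n::nat. f \<le> c + x / 2 ^ n"
  shows "f \<le> c"
proof -
  have "(\<lambda>n. c + x * (1 / 2) ^ n) \<longlonglongrightarrow> c + x * 0"
    by (intro tendsto_intros) auto
  then have "f \<le> c + x * 0"
  proof (rule LIMSEQ_le_const)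
    show "\<exists>N. \<forall>n\<ge>N. f \<le> c + x * (1 / 2) ^ n"
      using assms by (simp add: power_one_over)
  qed
  then show ?thesis by simp
qed

text \<open>The weight \<open>1 - G\<close> may vanish away from the origin, but it is at least \<open>1/2\<close> on some
  \<open>[0,d]\<close>, so integrability propagates along steps of length \<open>d\<close>.\<close>
lemma set_integrable_of_tail_weighted:
  fixes D g G :: "real \<Rightarrow> real"
  assumes g: "set_integrable lborel {0..} g" and g0: "\<And>x. x \<ge> 0 \<Longrightarrow> g x \<ge> 0"
    and G: "\<And>x. x \<ge> 0 \<Longrightarrow> G x = (\<integral>y\<in>{0..x}. g y \<partial>lborel)" and Gneg: "\<And>x. x < 0 \<Longrightarrow> G x = 0"
    and D: "\<And>t. t \<ge> 0 \<Longrightarrow> set_integrable lborel {0..t} (\<lambda>u. (1 - G (t - u)) * D u)"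
  shows "set_integrable lborel {0..t} D"
proof -
  have quarter: "(1 / 4 :: real) > 0" by simp
  obtain N where N: "N > 0"
    "\<And>A w. \<lbrakk>A \<in> sets lborel; A \<subseteq> {0..}; set_integrable lborel A w; \<And>x. x \<in> A \<Longrightarrow> 0 \<le> w x \<and> w x \<le> 1;
        \<And>x. x \<in> A \<Longrightarrow> 0 \<le> g x\<rbrakk> \<Longrightarrow> (\<integral>x\<in>A. g x * w x \<partial>lborel) \<le> 1 / 4 + N * (\<integral>x\<in>A. w x \<partial>lborel)"
    using set_integral_mult_small_weight_le[OF g quarter] by blast
  \<comment> \<open>On \<open>[0,d]\<close> the truncation error 1/4 and the term
    \<open>N * d = 1/4\<close> add up to \<open>G \<le> 1/2\<close>.\<close>
  define d where "d = 1 / (4 * N)"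
  have d: "d > 0" using N(1) by (simp add: d_def)
  have Gd: "G x \<le> 1 / 2" if x: "0 \<le> x" "x \<le> d" for x
  proof -
    have "(\<integral>y\<in>{0..x}. g y * 1 \<partial>lborel) \<le> 1 / 4 + N * (\<integral>y\<in>{0..x}. 1 \<partial>lborel)"
      by (rule N(2)) (auto intro!: g0 borel_integrable_atLeastAtMost')
    also have "N * (\<integral>y\<in>{0..x}. 1 \<partial>lborel) \<le> N * d"
      using x N(1) by (simp add: set_lebesgue_integral_def)
    finally show ?thesis using G x N(1) by (simp add: d_def)
  qed
  \<comment> \<open>Monotonicity on the whole line makes \<open>G\<close> Borel measurable, so that
    dividing the weighted integrand by \<open>1 - G\<close> recovers a measurable
    \<open>D\<close>.\<close>
  have mono: "mono G"
  proof (rule monoI)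
    fix x y :: real assume xy: "x \<le> y"
    have pos: "0 \<le> G z" for z
      using g0 by (cases "z < 0") (auto simp: Gneg G set_lebesgue_integral_def indicator_def intro!: Bochner_Integration.integral_nonneg)
    show "G x \<le> G y"
    proof (cases "x < 0")
      case True
      then show ?thesis using pos[of y] by (simp add: Gneg)
    next
      case False
      have gi: "set_integrable lborel {0..z} g" for z
        by (rule set_integrable_subset[OF g]) auto
      have "(\<integral>u\<in>{0..x}. g u \<partial>lborel) \<le> (\<integral>u\<in>{0..y}. g u \<partial>lborel)"
        using gi[of x] gi[of y] xy g0 unfolding set_lebesgue_integral_def set_integrable_def
        by (intro integral_mono) (auto simp: indicator_def)
      then show ?thesis using False xy by (simp add: G)
    qed
  qed
  then have [measurable]: "G \<in> borel_measurable borel"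
    by (rule borel_measurable_mono)
  have step: "set_integrable lborel {0..real n * d} D" for n :: nat
  proof (induction n)
    case 0
    then show ?case by simp
  next
    case (Suc n)
    let ?a = "real n * d" and ?b = "real (Suc n) * d"
    have ab: "0 \<le> ?a" "?a \<le> ?b" "?b - ?a = d" using d by (auto simp: algebra_simps)
    \<comment> \<open>The hypothesis is taken at the right end \<open>?b\<close>: on the last step
      of length \<open>d\<close> the argument \<open>?b - u\<close> stays in \<open>[0,d]\<close>,
      where the weight is at least 1/2.\<close>
    have wi: "set_integrable lborel {?a..?b} (\<lambda>u. (1 - G (?b - u)) * D u)"
      by (rule set_integrable_subset[OF D[of ?b]]) (use ab in auto)
    let ?W = "\<lambda>u. indicator {?a..?b} u *\<^sub>R ((1 - G (?b - u)) * D u)"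
    have wW: "integrable lborel ?W" using wi by (simp add: set_integrable_def)
    then have [measurable]: "?W \<in> borel_measurable lborel" by auto
    have half: "1 - G (?b - u) \<ge> 1 / 2" if "u \<in> {?a..?b}" for u
      using Gd[of "?b - u"] that ab by auto
    have eq: "(\<lambda>u. indicator {?a..?b} u *\<^sub>R D u) = (\<lambda>u. ?W u * (1 / (1 - G (?b - u))))"
      using half by (fastforce simp: indicator_def fun_eq_iff)
    have "set_integrable lborel {?a..?b} D"
      unfolding set_integrable_def
    proof (rule Bochner_Integration.integrable_bound)
      show "integrable lborel (\<lambda>u. 2 * ?W u)" using wW by simp
      show "(\<lambda>u. indicator {?a..?b} u *\<^sub>R D u) \<in> borel_measurable lborel"
        unfolding eq by measurable
      show "AE u in lborel. norm (indicator {?a..?b} u *\<^sub>R D u) \<le> norm (2 * ?W u)"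
      proof (rule AE_I2)
        fix u
        show "norm (indicator {?a..?b} u *\<^sub>R D u) \<le> norm (2 * ?W u)"
        proof (cases "u \<in> {?a..?b}")
          case True
          have "1 * \<bar>D u\<bar> \<le> (2 * (1 - G (?b - u))) * \<bar>D u\<bar>"
            using half[OF True] by (intro mult_right_mono) auto
          then show ?thesis using True half[OF True] by (simp add: abs_mult algebra_simps)
        qed simp
      qed
    qed
    then have "set_integrable lborel ({0..?a} \<union> {?a..?b}) D"
      using Suc by (intro set_integrable_Un) auto
    moreover have "{0..?a} \<union> {?a..?b} = {0..?b}"
      using ab(1,2) by (rule ivl_disj_un_two_touch(4))
    ultimately show ?case by simp
  qed
  obtain n :: nat where "t / d \<le> real n" using real_arch_simple by blast
  then have "t \<le> real n * d" using d by (simp add: field_simps)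
  then show ?thesis
    by (intro set_integrable_subset[OF step[of n]]) auto
qed


section \<open>Vanishing of the differences in the delayed system\<close>

lemma set_integrable_mult_bounded:
  fixes p w :: "real \<Rightarrow> real"
  assumes p: "set_integrable lborel S p" and w: "w \<in> borel_measurable borel"
    and le: "\<And>x. x \<in> S \<Longrightarrow> \<bar>w x\<bar> \<le> 1"
  shows "set_integrable lborel S (\<lambda>x. p x * w x)"
proof -
  have pi: "integrable lborel (\<lambda>x. indicator S x *\<^sub>R p x)"
    using p by (simp add: set_integrable_def)
  have eq: "(\<lambda>x. indicator S x *\<^sub>R (p x * w x)) = (\<lambda>x. (indicator S x *\<^sub>R p x) * w x)"
    by auto
  show ?thesis
    unfolding set_integrable_def
  proof (rule Bochner_Integration.integrable_bound[OF pi])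
    show "(\<lambda>x. indicator S x *\<^sub>R (p x * w x)) \<in> borel_measurable lborel"
      unfolding eq using borel_measurable_integrable[OF pi] w by (intro borel_measurable_times) auto
    show "AE x in lborel. norm (indicator S x *\<^sub>R (p x * w x)) \<le> norm (indicator S x *\<^sub>R p x)"
      using le by (intro AE_I2) (auto simp: abs_mult indicator_def mult_left_le)
  qed
qed

text \<open>Here \<open>dZ\<close>, \<open>D\<close> and \<open>Phi\<close> play the differences of
  two solutions, of their boundary derivatives and of their sources. The nonlinearity enters only
  through the Lipschitz bound on \<open>Phi\<close>, which is uniform in the level and compares
  quantities at the same time. This suffices for a contraction in the weighted norm on
  \<open>[0,T]\<close>.\<close>

lemma delayed_system_trivial:
  fixes g G lam :: "real \<Rightarrow> real" and D :: "nat \<Rightarrow> real \<Rightarrow> real"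
    and dZ Phi :: "nat \<Rightarrow> real \<Rightarrow> real \<Rightarrow> real"
  assumes g: "set_integrable lborel {0..} g" and g0: "\<And>x. x \<ge> 0 \<Longrightarrow> g x \<ge> 0"
    and g1: "(\<integral>x\<in>{0..}. g x \<partial>lborel) \<le> 1"
    and G: "\<And>x. x \<ge> 0 \<Longrightarrow> G x = (\<integral>y\<in>{0..x}. g y \<partial>lborel)"
    and lam: "\<And>T. T \<ge> 0 \<Longrightarrow> set_integrable lborel {0..T} lam" and lam0: "\<And>x. x \<ge> 0 \<Longrightarrow> lam x \<ge> 0"
    and D: "\<And>l t. l \<ge> 2 \<Longrightarrow> t \<ge> 0 \<Longrightarrow> set_integrable lborel {0..t} (D l)"
    and GD: "\<And>l t r. \<lbrakk>l \<ge> 2; t \<ge> 0; r \<ge> 0\<rbrakk> \<Longrightarrow> set_integrable lborel {0..t} (\<lambda>u. (1 - G (t + r - u)) * D l u)"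
    and eq1: "\<And>l t r. \<lbrakk>l \<ge> 1; t \<ge> 0; r \<ge> 0\<rbrakk> \<Longrightarrow> dZ l t r =
        (\<integral>u\<in>{0..t}. lam u * Phi l u (t + r - u) \<partial>lborel)
        - (\<integral>u\<in>{0..t}. (1 - G (t + r - u)) * D (Suc l) u \<partial>lborel)"
    and eq2: "\<And>l t. \<lbrakk>l \<ge> 2; t \<ge> 0\<rbrakk> \<Longrightarrow> dZ l t 0 =
        (\<integral>u\<in>{0..t}. D l u - D (Suc l) u \<partial>lborel) + (\<integral>u\<in>{0..t}. lam u * Phi l u 0 \<partial>lborel)"
    and Phi: "\<And>l u s M. \<lbrakk>l \<ge> 1; u \<ge> 0; s \<ge> 0; \<And>k r. k \<ge> 1 \<Longrightarrow> r \<ge> 0 \<Longrightarrow> \<bar>dZ k u r\<bar> \<le> M\<rbrakk>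
        \<Longrightarrow> \<bar>Phi l u s\<bar> \<le> 8 * M"
    and dZ2: "\<And>l t r. \<lbrakk>l \<ge> 1; t \<ge> 0; r \<ge> 0\<rbrakk> \<Longrightarrow> \<bar>dZ l t r\<bar> \<le> 2"
    and ltr: "l \<ge> 1" "T \<ge> 0" "r \<ge> 0"
  shows "dZ l T r = 0"
proof -
  define A where "A l t = (\<integral>u\<in>{0..t}. D l u \<partial>lborel)" for l t
  \<comment> \<open>For \<open>y < r\<close> the argument of \<open>A\<close> is frozen at
    \<open>t\<close>, as \<open>D\<close> is integrated no further than \<open>t\<close>. Only at
    \<open>r = 0\<close> is this a genuine convolution of \<open>g\<close> with
    \<open>A\<close>.\<close>
  define C where "C l t r = (\<integral>y\<in>{0..t+r}. g y * A l (min t (t + r - y)) \<partial>lborel)" for l t r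
  define J where "J l t r = (\<integral>u\<in>{0..t}. lam u * Phi l u (t + r - u) \<partial>lborel)" for l t r
  define J0 where "J0 l t = (\<integral>u\<in>{0..t}. lam u * Phi l u 0 \<partial>lborel)" for l t
  have dZ_eq: "dZ l t r = J l t r - A (Suc l) t + C (Suc l) t r"
    if h: "l \<ge> 1" "t \<ge> 0" "r \<ge> 0" for l t r
  proof -
    have l2: "Suc l \<ge> 2" using h by simp
    have "(\<integral>u\<in>{0..t}. G (t + r - u) * D (Suc l) u \<partial>lborel)
        = (\<integral>u\<in>{0..t}. D (Suc l) u - (1 - G (t + r - u)) * D (Suc l) u \<partial>lborel)"
      by (simp add: algebra_simps)
    also have "\<dots> = A (Suc l) t - (\<integral>u\<in>{0..t}. (1 - G (t + r - u)) * D (Suc l) u \<partial>lborel)"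
      unfolding A_def by (rule set_integral_diff(2)[OF D[OF l2 h(2)] GD[OF l2 h(2,3)]])
    finally show ?thesis
      using convolution_by_parts[OF D[OF l2 h(2)] g G h(2,3)] eq1[OF h]
      by (simp add: A_def C_def J_def)
  qed
  \<comment> \<open>At \<open>r = 0\<close> both equations for \<open>dZ\<close> contain
    \<open>- A (Suc l) t\<close>, which cancels when they are equated.\<close>
  have A_eq: "A l t = C (Suc l) t 0 + J l t 0 - J0 l t" if h: "l \<ge> 2" "t \<ge> 0" for l t
  proof -
    have "(\<integral>u\<in>{0..t}. D l u - D (Suc l) u \<partial>lborel) = A l t - A (Suc l) t"
      unfolding A_def using h by (intro set_integral_diff(2) D) auto
    then show ?thesis
      using dZ_eq[of l t 0] eq2[OF h] h by (simp add: J0_def)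
  qed

  \<comment> \<open>Any sufficiently small constant would do. The contraction below needs
    \<open>(1 + 64 + 64) / 300 \<le> 1/2\<close>, for one convolution term and two source
    terms.\<close>
  have eps: "(1 / 300 :: real) > 0" by simp
  have gT: "set_integrable lborel {0..T} g"
    by (rule set_integrable_subset[OF g]) auto
  obtain Kg where Kg: "Kg > 0"
    "\<And>K t. \<lbrakk>K \<ge> Kg; 0 \<le> t; t \<le> T\<rbrakk> \<Longrightarrow> (\<integral>u\<in>{0..t}. g u * exp (- K * u) \<partial>lborel) \<le> 1 / 300"
    by (rule set_integral_exp_damped_small[OF gT g0 eps]) (simp_all only:)
  obtain Kl where Kl: "Kl > 0"
    "\<And>K t. \<lbrakk>K \<ge> Kl; 0 \<le> t; t \<le> T\<rbrakk> \<Longrightarrow> (\<integral>u\<in>{0..t}. lam u * exp (- K * (t - u)) \<partial>lborel) \<le> 1 / 300"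
    by (rule set_integral_exp_damped_small[OF lam[OF ltr(2)] lam0 eps]) (simp_all only:)
  define K where "K = max Kg Kl"
  have K: "K \<ge> Kg" "K \<ge> Kl" "K > 0" using Kg(1) by (auto simp: K_def)

  \<comment> \<open>At \<open>r = 0\<close> the bound on \<open>A k (t - y)\<close> carries the
    factor \<open>exp (- K * y)\<close>, and the damped integral of \<open>g\<close> supplies the
    gain 1/300.\<close>
  have C0_le: "\<bar>C k t 0\<bar> \<le> x / 300 * exp (K * t)"
    if x: "x \<ge> 0" and t: "0 \<le> t" "t \<le> T"
      and a: "\<And>s. \<lbrakk>0 \<le> s; s \<le> T\<rbrakk> \<Longrightarrow> \<bar>A k s\<bar> \<le> x * exp (K * s)" for k t x
  proof -
    have i: "set_integrable lborel {0..t} (\<lambda>y. g y * exp (- K * y))"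
      by (intro set_integrable_mult_bounded set_integrable_subset[OF g]) (use K in auto)
    have "\<bar>C k t 0\<bar> \<le> (\<integral>y\<in>{0..t+0}. (x * exp (K * t)) * (g y * exp (- K * y)) \<partial>lborel)"
      unfolding C_def
    proof (rule abs_set_integral_le)
      show "set_integrable lborel {0..t+0} (\<lambda>y. (x * exp (K * t)) * (g y * exp (- K * y)))"
        using i by simp
      fix y assume y: "y \<in> {0..t+0}"
      have "\<bar>g y * A k (min t (t + 0 - y))\<bar> = g y * \<bar>A k (t - y)\<bar>"
        using y g0[of y] by (simp add: abs_mult)
      also have "\<dots> \<le> g y * (x * exp (K * (t - y)))"
        using y t g0[of y] by (intro mult_left_mono a) auto
      also have "exp (K * (t - y)) = exp (K * t) * exp (- K * y)"
        by (simp add: exp_add[symmetric] algebra_simps)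
      finally show "\<bar>g y * A k (min t (t + 0 - y))\<bar> \<le> (x * exp (K * t)) * (g y * exp (- K * y))"
        by (simp add: algebra_simps)
    qed
    also have "\<dots> = (x * exp (K * t)) * (\<integral>y\<in>{0..t}. g y * exp (- K * y) \<partial>lborel)"
      by simp
    also have "\<dots> \<le> (x * exp (K * t)) * (1 / 300)"
      using Kg(2)[OF K(1) t] x by (intro mult_left_mono) auto
    finally show ?thesis by simp
  qed
  have C_le: "\<bar>C k t r\<bar> \<le> x * exp (K * t)"
    if x: "x \<ge> 0" and t: "0 \<le> t" "t \<le> T" "0 \<le> r"
      and a: "\<And>s. \<lbrakk>0 \<le> s; s \<le> T\<rbrakk> \<Longrightarrow> \<bar>A k s\<bar> \<le> x * exp (K * s)" for k t r x
  proof -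
    have i: "set_integrable lborel {0..t+r} g"
      by (intro set_integrable_subset[OF g]) auto
    have "\<bar>C k t r\<bar> \<le> (\<integral>y\<in>{0..t+r}. (x * exp (K * t)) * g y \<partial>lborel)"
      unfolding C_def
    proof (rule abs_set_integral_le)
      show "set_integrable lborel {0..t+r} (\<lambda>y. (x * exp (K * t)) * g y)"
        using i by simp
      fix y assume y: "y \<in> {0..t+r}"
      let ?m = "min t (t + r - y)"
      have m: "0 \<le> ?m" "?m \<le> T" "?m \<le> t" using y t by auto
      have "\<bar>A k ?m\<bar> \<le> x * exp (K * ?m)" using m by (intro a) auto
      also have "\<dots> \<le> x * exp (K * t)"
        using m x K by (intro mult_left_mono) auto
      finally have "g y * \<bar>A k ?m\<bar> \<le> g y * (x * exp (K * t))"
        using y g0[of y] by (intro mult_left_mono) auto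
      then show "\<bar>g y * A k ?m\<bar> \<le> (x * exp (K * t)) * g y"
        using y g0[of y] by (simp add: abs_mult mult.commute)
    qed
    also have "\<dots> = (x * exp (K * t)) * (\<integral>y\<in>{0..t+r}. g y \<partial>lborel)"
      by simp
    also have "(\<integral>y\<in>{0..t+r}. g y \<partial>lborel) \<le> (\<integral>y\<in>{0..}. g y \<partial>lborel)"
      using i g g0 unfolding set_lebesgue_integral_def set_integrable_def
      by (intro integral_mono) (auto simp: indicator_def)
    also have "\<dots> \<le> 1" by (rule g1)
    finally show ?thesis using x by (simp add: mult_left_mono)
  qed
  have lam_le: "\<bar>\<integral>u\<in>{0..t}. lam u * f u \<partial>lborel\<bar> \<le> x / 300 * exp (K * t)"
    if x: "x \<ge> 0" and t: "0 \<le> t" "t \<le> T"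
      and f: "\<And>u. \<lbrakk>0 \<le> u; u \<le> t\<rbrakk> \<Longrightarrow> \<bar>f u\<bar> \<le> x * exp (K * u)" for f :: "real \<Rightarrow> real" and t x
  proof -
    have i: "set_integrable lborel {0..t} (\<lambda>u. lam u * exp (- K * (t - u)))"
      by (intro set_integrable_mult_bounded lam) (use K t in auto)
    have "\<bar>\<integral>u\<in>{0..t}. lam u * f u \<partial>lborel\<bar> \<le> (\<integral>u\<in>{0..t}. (x * exp (K * t)) * (lam u * exp (- K * (t - u))) \<partial>lborel)"
    proof (rule abs_set_integral_le)
      show "set_integrable lborel {0..t} (\<lambda>u. (x * exp (K * t)) * (lam u * exp (- K * (t - u))))"
        using i by simp
      fix u assume u: "u \<in> {0..t}"
      have "\<bar>lam u * f u\<bar> \<le> lam u * (x * exp (K * u))"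
        using u lam0[of u] f[of u] by (auto simp: abs_mult intro!: mult_left_mono)
      also have "exp (K * u) = exp (K * t) * exp (- K * (t - u))"
        by (simp add: exp_add[symmetric] algebra_simps)
      finally show "\<bar>lam u * f u\<bar> \<le> (x * exp (K * t)) * (lam u * exp (- K * (t - u)))"
        by (simp add: algebra_simps)
    qed
    also have "\<dots> = (x * exp (K * t)) * (\<integral>u\<in>{0..t}. lam u * exp (- K * (t - u)) \<partial>lborel)"
      by simp
    also have "\<dots> \<le> (x * exp (K * t)) * (1 / 300)"
      using Kl(2)[OF K(2) t] x by (intro mult_left_mono) auto
    finally show ?thesis by simp
  qed

  \<comment> \<open>A bound for \<open>dZ\<close> and \<open>J\<close> together: 2 comes from
    \<open>dZ2\<close>, and \<open>16 = 8 * 2\<close> from the Lipschitz bound on \<open>Phi\<close>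
    with \<open>M = 2\<close>.\<close>
  define c where "c = 2 + 16 * (\<integral>u\<in>{0..T}. lam u \<partial>lborel)"
  have lamT: "0 \<le> (\<integral>u\<in>{0..T}. lam u \<partial>lborel)"
    using lam0 unfolding set_lebesgue_integral_def
    by (intro Bochner_Integration.integral_nonneg) (auto simp: indicator_def)
  \<comment> \<open>The renewal equation is \<open>dZ_eq\<close> at \<open>r = 0\<close>, solved for
    \<open>A (Suc l) t\<close>. The iteration starts from \<open>x0\<close>, the integral of the
    absolute value of \<open>D (Suc l)\<close>, which depends on \<open>l\<close>; repeated halving
    removes it and leaves \<open>2 * c\<close>, the same for all levels.\<close>
  have A_rough: "\<bar>A (Suc l) t\<bar> \<le> 2 * c * exp (K * t)" if l: "l \<ge> 1" and t: "0 \<le> t" "t \<le> T" for l t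
  proof -
    have DT: "set_integrable lborel {0..T} (\<lambda>u. \<bar>D (Suc l) u\<bar>)"
      using l ltr by (intro set_integrable_abs D) auto
    define x0 where "x0 = (\<integral>u\<in>{0..T}. \<bar>D (Suc l) u\<bar> \<partial>lborel)"
    have Dle: "(\<integral>u\<in>{0..t}. \<bar>D (Suc l) u\<bar> \<partial>lborel) \<le> x0" if "t \<le> T" for t
      using DT set_integrable_subset[OF DT, of "{0..t}"] that
      unfolding x0_def set_lebesgue_integral_def set_integrable_def
      by (intro integral_mono) (auto simp: indicator_def)
    have x0: "0 \<le> x0" unfolding x0_def set_lebesgue_integral_def
      by (intro Bochner_Integration.integral_nonneg) (auto simp: indicator_def)
    have "\<forall>t. 0 \<le> t \<and> t \<le> T \<longrightarrow> \<bar>A (Suc l) t\<bar> \<le> (2 * c + x0 / 2 ^ n) * exp (K * t)" for n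
    proof (induction n)
      case 0
      have "\<bar>A (Suc l) t\<bar> \<le> (2 * c + x0) * exp (K * t)" if t: "0 \<le> t" "t \<le> T" for t
      proof -
        have "\<bar>A (Suc l) t\<bar> \<le> (\<integral>u\<in>{0..t}. \<bar>D (Suc l) u\<bar> \<partial>lborel)"
          unfolding A_def using set_integrable_subset[OF DT, of "{0..t}"] t
          by (intro abs_set_integral_le) auto
        also have "\<dots> \<le> (2 * c + x0) * 1" using Dle t lamT by (auto simp: c_def intro: add_increasing)
        also have "\<dots> \<le> (2 * c + x0) * exp (K * t)"
          using x0 lamT t K by (intro mult_left_mono) (auto simp: c_def)
        finally show ?thesis .
      qed
      then show ?case by simp
    next
      case (Suc n)
      show ?case
      proof (intro allI impI)
        fix t assume t: "0 \<le> t \<and> t \<le> T"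
        let ?x = "2 * c + x0 / 2 ^ n"
        have cx: "c \<ge> 2" "x0 / 2 ^ n \<ge> 0" using lamT x0 by (auto simp: c_def)
        have C: "\<bar>C (Suc l) t 0\<bar> \<le> ?x / 300 * exp (K * t)"
          using Suc cx t by (intro C0_le) auto
        have lt: "set_integrable lborel {0..t} lam" using t by (intro lam) auto
        have "\<bar>J l t 0\<bar> \<le> (\<integral>u\<in>{0..t}. 16 * lam u \<partial>lborel)"
          unfolding J_def
        proof (rule abs_set_integral_le)
          show "set_integrable lborel {0..t} (\<lambda>u. 16 * lam u)" using lt by simp
          fix u assume u: "u \<in> {0..t}"
          have "\<bar>Phi l u (t + 0 - u)\<bar> \<le> 8 * 2"
            using u l by (intro Phi dZ2) auto
          then have "lam u * \<bar>Phi l u (t + 0 - u)\<bar> \<le> lam u * 16"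
            using lam0[of u] u by (intro mult_left_mono) auto
          then show "\<bar>lam u * Phi l u (t + 0 - u)\<bar> \<le> 16 * lam u"
            using lam0[of u] u by (simp add: abs_mult)
        qed
        also have "\<dots> = 16 * (\<integral>u\<in>{0..t}. lam u \<partial>lborel)" by simp
        also have "(\<integral>u\<in>{0..t}. lam u \<partial>lborel) \<le> (\<integral>u\<in>{0..T}. lam u \<partial>lborel)"
          using lt lam[of T] lam0 t ltr unfolding set_lebesgue_integral_def set_integrable_def
          by (intro integral_mono) (auto simp: indicator_def)
        finally have J: "\<bar>J l t 0\<bar> \<le> c - 2" by (simp add: c_def)
        have "\<bar>dZ l t 0\<bar> \<le> 2" using l t by (intro dZ2) auto
        then have "\<bar>A (Suc l) t\<bar> \<le> c * 1 + ?x / 300 * exp (K * t)"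
          using dZ_eq[of l t 0] l t J C by linarith
        also have "c * 1 \<le> c * exp (K * t)"
          using cx t K by (intro mult_left_mono) auto
        also have "c * exp (K * t) + ?x / 300 * exp (K * t) = (c + ?x / 300) * exp (K * t)"
          by (simp add: algebra_simps)
        also have "\<dots> \<le> (2 * c + x0 / 2 ^ Suc n) * exp (K * t)"
          using cx by (intro mult_right_mono) auto
        finally show "\<bar>A (Suc l) t\<bar> \<le> (2 * c + x0 / 2 ^ Suc n) * exp (K * t)" by simp
      qed
    qed
    then have "\<bar>A (Suc l) t\<bar> \<le> 2 * c * exp (K * t) + (x0 * exp (K * t)) / 2 ^ n" for n
      using t by (simp add: distrib_right)
    then show ?thesis by (rule le_of_le_plus_halving)
  qed

  \<comment> \<open>The transport equation loses a constant: it bounds \<open>dZ\<close> by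
    \<open>A\<close> and \<open>C\<close> without any gain. Allowing \<open>dZ\<close> a bound 8
    times that of \<open>A\<close> absorbs this loss.\<close>
  define P where "P x \<longleftrightarrow>
      (\<forall>l t. 2 \<le> l \<and> 0 \<le> t \<and> t \<le> T \<longrightarrow> \<bar>A l t\<bar> \<le> x * exp (K * t)) \<and>
      (\<forall>l t r. 1 \<le> l \<and> 0 \<le> t \<and> t \<le> T \<and> 0 \<le> r \<longrightarrow> \<bar>dZ l t r\<bar> \<le> 8 * x * exp (K * t))" for x
  have P_start: "P (2 * c)"
    unfolding P_def
  proof (intro conjI allI impI)
    fix l :: nat and t assume h: "2 \<le> l \<and> 0 \<le> t \<and> t \<le> T"
    then have "1 \<le> l - 1" "Suc (l - 1) = l" by auto
    then show "\<bar>A l t\<bar> \<le> 2 * c * exp (K * t)"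
      using A_rough[of "l - 1" t] h by simp
  next
    fix l :: nat and t r assume h: "1 \<le> l \<and> 0 \<le> t \<and> t \<le> T \<and> (0::real) \<le> r"
    have "\<bar>dZ l t r\<bar> \<le> 2" using h by (intro dZ2) auto
    also have "\<dots> \<le> 8 * (2 * c) * 1" using lamT by (simp add: c_def)
    also have "\<dots> \<le> 8 * (2 * c) * exp (K * t)"
      using h K lamT by (intro mult_left_mono) (auto simp: c_def)
    finally show "\<bar>dZ l t r\<bar> \<le> 8 * (2 * c) * exp (K * t)" .
  qed
  \<comment> \<open>With \<open>Phi\<close> bounded by \<open>8 * 8 * x\<close>, the equation for
    \<open>A\<close> gives at most \<open>129/300 * x\<close>. The transport equation, fed with the
    old bound on \<open>A\<close>, gives at most \<open>(2 + 64/300) * x\<close> for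
    \<open>dZ\<close>, which is below \<open>8 * (x / 2)\<close>.\<close>
  have P_half: "P (x / 2)" if x: "x \<ge> 0" and P: "P x" for x
  proof -
    have PA: "\<bar>A l t\<bar> \<le> x * exp (K * t)" if "2 \<le> l" "0 \<le> t" "t \<le> T" for l t
      using P that by (auto simp: P_def)
    have Phi_le: "\<bar>Phi l u s\<bar> \<le> (64 * x) * exp (K * u)"
      if "1 \<le> l" "0 \<le> u" "u \<le> T" "0 \<le> s" for l u s
    proof -
      have "\<bar>Phi l u s\<bar> \<le> 8 * (8 * x * exp (K * u))"
        using P that by (intro Phi) (auto simp: P_def)
      then show ?thesis by simp
    qed
    have J_le: "\<bar>J l t r\<bar> \<le> (64 * x) / 300 * exp (K * t)"
      if "1 \<le> l" "0 \<le> t" "t \<le> T" "0 \<le> r" for l t r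
      unfolding J_def using that x by (intro lam_le Phi_le) auto
    have J0_le: "\<bar>J0 l t\<bar> \<le> (64 * x) / 300 * exp (K * t)"
      if "1 \<le> l" "0 \<le> t" "t \<le> T" for l t
      unfolding J0_def using that x by (intro lam_le Phi_le) auto
    have xe: "0 \<le> x * exp (K * t)" for t using x by simp
    show ?thesis
      unfolding P_def
    proof (intro conjI allI impI)
      fix l :: nat and t assume h: "2 \<le> l \<and> 0 \<le> t \<and> t \<le> T"
      have "\<bar>C (Suc l) t 0\<bar> \<le> x / 300 * exp (K * t)"
        using x h by (intro C0_le PA) auto
      then show "\<bar>A l t\<bar> \<le> x / 2 * exp (K * t)"
        using A_eq[of l t] J_le[of l t 0] J0_le[of l t] xe[of t] h by (simp add: field_simps)
    next
      fix l :: nat and t r assume h: "1 \<le> l \<and> 0 \<le> t \<and> t \<le> T \<and> (0::real) \<le> r"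
      have "\<bar>C (Suc l) t r\<bar> \<le> x * exp (K * t)"
        using x h by (intro C_le PA) auto
      then show "\<bar>dZ l t r\<bar> \<le> 8 * (x / 2) * exp (K * t)"
        using dZ_eq[of l t r] J_le[of l t r] PA[of "Suc l" t] xe[of t] h by (simp add: field_simps)
    qed
  qed
  have "P (2 * c / 2 ^ n)" for n :: nat
  proof (induction n)
    case 0
    then show ?case using P_start by simp
  next
    case (Suc n)
    then show ?case using P_half[of "2 * c / 2 ^ n"] lamT by (simp add: c_def field_simps)
  qed
  then have "\<bar>dZ l T r\<bar> \<le> 8 * (2 * c / 2 ^ n) * exp (K * T)" for n
    using ltr unfolding P_def by blast
  then have "\<bar>dZ l T r\<bar> \<le> 0 + (16 * c * exp (K * T)) / 2 ^ n" for n
    by (simp add: field_simps)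
  then have "\<bar>dZ l T r\<bar> \<le> 0" by (rule le_of_le_plus_halving)
  then show ?thesis by simp
qed


section \<open>From the hydrodynamic equations to the delayed system\<close>

text \<open>The arrival term shared by both equations; the second one uses it at \<open>s = 0\<close>.\<close>
definition flux :: "(real \<Rightarrow> real) \<Rightarrow> (nat \<Rightarrow> real \<Rightarrow> real \<Rightarrow> real) \<Rightarrow> nat \<Rightarrow> real \<Rightarrow> real \<Rightarrow> real" where
  "flux G Z l u s = (if l = 1 then (1 - G s) * (1 - (Z 1 u 0)^2)
     else (Z (l - 1) u 0 + Z l u 0) * (Z (l - 1) u s - Z l u s))"

text \<open>For \<open>l = 1\<close> the factor \<open>1 - G s\<close> of \<open>flux\<close>, taken
  at \<open>s = t + r - u\<close>, reproduces the kernel of the source term, so all levels share one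
  form of the equation.\<close>

lemma hydro_solution_transport:
  assumes "hydro_solution G lam Z0 Z" "l \<ge> 1" "t \<ge> 0" "r \<ge> 0"
  shows "set_integrable lborel {0..t} (\<lambda>u. (1 - G (t + r - u)) * dr (Z (Suc l)) u 0)"
    and "set_integrable lborel {0..t} (\<lambda>u. lam u * flux G Z l u (t + r - u))"
    and "Z l t r = Z0 l (t + r)
        - (\<integral>u\<in>{0..t}. (1 - G (t + r - u)) * dr (Z (Suc l)) u 0 \<partial>lborel)
        + (\<integral>u\<in>{0..t}. lam u * flux G Z l u (t + r - u) \<partial>lborel)"
  using assms unfolding hydro_solution_def flux_def Let_def
  by (cases "l = 1"; simp add: mult.assoc numeral_2_eq_2)+

text \<open>The difference of squares in the boundary source factorises into \<open>flux\<close> at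
  \<open>s = 0\<close>.\<close>

lemma hydro_solution_boundary:
  assumes "hydro_solution G lam Z0 Z" "l \<ge> 2" "t \<ge> 0"
  shows "set_integrable lborel {0..t} (\<lambda>u. dr (Z l) u 0 - dr (Z (Suc l)) u 0)"
    and "set_integrable lborel {0..t} (\<lambda>u. lam u * flux G Z l u 0)"
    and "Z l t 0 = Z0 l 0
        + (\<integral>u\<in>{0..t}. dr (Z l) u 0 - dr (Z (Suc l)) u 0 \<partial>lborel)
        + (\<integral>u\<in>{0..t}. lam u * flux G Z l u 0 \<partial>lborel)"
proof -
  \<comment> \<open>The equations are instantiated at \<open>r = 0\<close>; the first six conjuncts
    concern level 1 and are skipped.\<close>
  note eqs = assms(1)[unfolded hydro_solution_def Let_def, THEN spec[of _ t], THEN mp, OF assms(3),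
      THEN spec[of _ 0], THEN mp, OF order_refl, THEN conjunct2, THEN conjunct2, THEN conjunct2,
      THEN conjunct2, THEN conjunct2, THEN conjunct2, THEN spec[of _ l], THEN mp, OF assms(2)]
  have sq: "flux G Z l u 0 = (Z (l - 1) u 0)^2 - (Z l u 0)^2" for u
    using assms(2) by (simp add: flux_def power2_eq_square algebra_simps)
  show "set_integrable lborel {0..t} (\<lambda>u. dr (Z l) u 0 - dr (Z (Suc l)) u 0)"
    and "set_integrable lborel {0..t} (\<lambda>u. lam u * flux G Z l u 0)"
    and "Z l t 0 = Z0 l 0
        + (\<integral>u\<in>{0..t}. dr (Z l) u 0 - dr (Z (Suc l)) u 0 \<partial>lborel)
        + (\<integral>u\<in>{0..t}. lam u * flux G Z l u 0 \<partial>lborel)"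
    using eqs[THEN conjunct2, THEN conjunct2, THEN conjunct2] unfolding sq Suc_eq_plus1 by blast+
qed

lemma abs_mult_diff_le:
  fixes a b a' b' :: real
  assumes "\<bar>a\<bar> \<le> p" "\<bar>b'\<bar> \<le> q" "\<bar>a - a'\<bar> \<le> d" "\<bar>b - b'\<bar> \<le> e"
  shows "\<bar>a * b - a' * b'\<bar> \<le> p * e + d * q"
proof -
  have "a * b - a' * b' = a * (b - b') + (a - a') * b'" by (simp add: algebra_simps)
  also have "\<bar>\<dots>\<bar> \<le> \<bar>a\<bar> * \<bar>b - b'\<bar> + \<bar>a - a'\<bar> * \<bar>b'\<bar>"
    by (metis abs_mult abs_triangle_ineq)
  also have "\<dots> \<le> p * e + d * q"
    using assms by (intro add_mono mult_mono) auto
  finally show ?thesis .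
qed

text \<open>For \<open>l \<ge> 2\<close> both factors are bounded by 2 and change by at most
  \<open>2 * M\<close>, whence \<open>2 * (2 * M) + (2 * M) * 2\<close>. Level 1 contributes only
  \<open>2 * M\<close>. The bound \<open>M\<close> ranges over levels and positions because
  \<open>flux\<close> couples level \<open>l\<close> with \<open>l - 1\<close> and position
  \<open>s\<close> with 0.\<close>

lemma flux_diff_le:
  assumes Z: "\<And>k r. k \<ge> 1 \<Longrightarrow> r \<ge> 0 \<Longrightarrow> \<bar>Z k u r\<bar> \<le> 1"
    and Z': "\<And>k r. k \<ge> 1 \<Longrightarrow> r \<ge> 0 \<Longrightarrow> \<bar>Z' k u r\<bar> \<le> 1"
    and M: "\<And>k r. k \<ge> 1 \<Longrightarrow> r \<ge> 0 \<Longrightarrow> \<bar>Z k u r - Z' k u r\<bar> \<le> M"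
    and G: "0 \<le> G s" "G s \<le> 1" and l: "l \<ge> 1" and s: "s \<ge> 0"
  shows "\<bar>flux G Z l u s - flux G Z' l u s\<bar> \<le> 8 * M"
proof (cases "l = 1")
  case True
  have M0: "M \<ge> 0" using M[of 1 0] by simp
  have sq: "\<bar>Z 1 u 0 * Z 1 u 0 - Z' 1 u 0 * Z' 1 u 0\<bar> \<le> 1 * M + M * 1"
    by (intro abs_mult_diff_le Z Z' M) auto
  have "flux G Z l u s - flux G Z' l u s =
      (1 - G s) * (Z' 1 u 0 * Z' 1 u 0 - Z 1 u 0 * Z 1 u 0)"
    using True by (simp add: flux_def power2_eq_square algebra_simps)
  also have "\<bar>\<dots>\<bar> \<le> 1 * (2 * M)"
    unfolding abs_mult using sq G by (intro mult_mono) auto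
  finally show ?thesis using M0 by simp
next
  case False
  then have k: "l - 1 \<ge> 1" using l by simp
  have "\<bar>flux G Z l u s - flux G Z' l u s\<bar> \<le> 2 * (2 * M) + (2 * M) * 2"
    unfolding flux_def if_not_P[OF False]
  proof (rule abs_mult_diff_le)
    show "\<bar>Z (l - 1) u 0 + Z l u 0\<bar> \<le> 2"
      using Z[OF k, of 0] Z[OF l, of 0] by simp
    show "\<bar>Z' (l - 1) u s - Z' l u s\<bar> \<le> 2"
      using Z'[OF k s] Z'[OF l s] by simp
    show "\<bar>Z (l - 1) u 0 + Z l u 0 - (Z' (l - 1) u 0 + Z' l u 0)\<bar> \<le> 2 * M"
      using M[OF k, of 0] M[OF l, of 0] by simp
    show "\<bar>Z (l - 1) u s - Z l u s - (Z' (l - 1) u s - Z' l u s)\<bar> \<le> 2 * M"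
      using M[OF k s] M[OF l s] by simp
  qed
  then show ?thesis by simp
qed

theorem theorem4p1:
  fixes G g :: "real \<Rightarrow> real" and H :: real and lam :: "real \<Rightarrow> real"
    and Z0 :: "nat \<Rightarrow> real \<Rightarrow> real"
    and Z Z' :: "nat \<Rightarrow> real \<Rightarrow> real \<Rightarrow> real"
  assumes g_nonneg: "\<forall>x\<ge>0. g x \<ge> 0"
    and g_int: "set_integrable lborel {0..} g"
    and g_total: "(\<integral>x\<in>{0..}. g x \<partial>lborel) = 1"
    and G_neg: "\<forall>x<0. G x = 0"
    and G_dens: "\<forall>x\<ge>0. G x = (\<integral>y\<in>{0..x}. g y \<partial>lborel)"
    and mean_int: "set_integrable lborel {0..} (\<lambda>x. x * g x)"
    and mean_one: "(\<integral>x\<in>{0..}. x * g x \<partial>lborel) = 1"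
    and hazard: "\<forall>x\<ge>0. g x / (1 - G x) \<le> H"
    and lam_nonneg: "\<forall>t\<ge>0. lam t \<ge> 0"
    and lam_loc_int: "\<forall>T\<ge>0. set_integrable lborel {0..T} lam"
    and Z0_C1: "\<forall>l\<ge>1. C1le1 (Z0 l)"
    and Z_X: "\<forall>l\<ge>1. inX (Z l)"
    and Z_sol: "hydro_solution G lam Z0 Z"
    and Z'_X: "\<forall>l\<ge>1. inX (Z' l)"
    and Z'_sol: "hydro_solution G lam Z0 Z'"
  shows "\<forall>l\<ge>1. \<forall>t\<ge>0. \<forall>r\<ge>0. Z l t r = Z' l t r"
proof (intro allI impI)
  fix l :: nat and t r :: real
  assume ltr: "1 \<le> l" "0 \<le> t" "0 \<le> r"
  have G01: "0 \<le> G x \<and> G x \<le> 1" if x: "x \<ge> 0" for x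
  proof -
    have gx: "set_integrable lborel {0..x} g"
      by (rule set_integrable_subset[OF g_int]) auto
    have "(\<integral>y\<in>{0..x}. g y \<partial>lborel) \<le> (\<integral>y\<in>{0..}. g y \<partial>lborel)"
      using gx g_int g_nonneg unfolding set_lebesgue_integral_def set_integrable_def
      by (intro integral_mono) (auto simp: indicator_def)
    moreover have "0 \<le> (\<integral>y\<in>{0..x}. g y \<partial>lborel)"
      using g_nonneg unfolding set_lebesgue_integral_def
      by (intro Bochner_Integration.integral_nonneg) (auto simp: indicator_def)
    ultimately show ?thesis using G_dens g_total x by simp
  qed
  have Z1: "\<bar>Z k u s\<bar> \<le> 1" and Z'1: "\<bar>Z' k u s\<bar> \<le> 1" if "k \<ge> 1" "u \<ge> 0" "s \<ge> 0" for k u s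
    using Z_X Z'_X that by (auto simp: inX_def C1le1_def)
  \<comment> \<open>The transport equation of level \<open>k - 1\<close> at \<open>r = 0\<close>
    yields integrability only under the weight \<open>1 - G\<close>; the weight is removed so that
    the primitives of the boundary derivatives make sense.\<close>
  have dr_int: "set_integrable lborel {0..t} (\<lambda>u. dr (W k) u 0)"
    if sol: "hydro_solution G lam Z0 W" and k: "k \<ge> 2" for W k t
  proof (rule set_integrable_of_tail_weighted[OF g_int])
    fix t :: real assume "t \<ge> 0"
    then show "set_integrable lborel {0..t} (\<lambda>u. (1 - G (t - u)) * dr (W k) u 0)"
      using hydro_solution_transport(1)[OF sol, of "k - 1" t 0] k by simp
  qed (use g_nonneg G_dens G_neg in auto)
  have "Z l t r - Z' l t r = 0"
  \<comment> \<open>Both solutions share the initial data \<open>Z0\<close>, which therefore drop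
    out of the differences.\<close>
  proof (rule delayed_system_trivial[OF g_int, where G=G and lam=lam
        and D="\<lambda>k u. dr (Z k) u 0 - dr (Z' k) u 0" and dZ="\<lambda>l t r. Z l t r - Z' l t r"
        and Phi="\<lambda>l u s. flux G Z l u s - flux G Z' l u s", OF _ _ _ _ _ _ _ _ _ _ _ ltr])
    fix k :: nat and t r :: real
    assume k: "2 \<le> k" and t: "0 \<le> t"
    show "set_integrable lborel {0..t} (\<lambda>u. dr (Z k) u 0 - dr (Z' k) u 0)"
      using dr_int[OF Z_sol k] dr_int[OF Z'_sol k] by (rule set_integral_diff(1))
    \<comment> \<open>Regrouping by solution instead of by level matches the integrands of the two
      boundary equations.\<close>
    have "(\<integral>u\<in>{0..t}. dr (Z k) u 0 - dr (Z' k) u 0 - (dr (Z (Suc k)) u 0 - dr (Z' (Suc k)) u 0) \<partial>lborel)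
        = (\<integral>u\<in>{0..t}. (dr (Z k) u 0 - dr (Z (Suc k)) u 0) - (dr (Z' k) u 0 - dr (Z' (Suc k)) u 0) \<partial>lborel)"
      by (simp add: algebra_simps)
    then show "Z k t 0 - Z' k t 0 =
        (\<integral>u\<in>{0..t}. dr (Z k) u 0 - dr (Z' k) u 0 - (dr (Z (Suc k)) u 0 - dr (Z' (Suc k)) u 0) \<partial>lborel)
        + (\<integral>u\<in>{0..t}. lam u * (flux G Z k u 0 - flux G Z' k u 0) \<partial>lborel)"
      using hydro_solution_boundary[OF Z_sol k t] hydro_solution_boundary[OF Z'_sol k t]
      by (simp add: right_diff_distrib)
    assume r: "0 \<le> r"
    have k1: "k - 1 \<ge> 1" and Sk: "Suc (k - 1) = k" using k by auto
    show "set_integrable lborel {0..t} (\<lambda>u. (1 - G (t + r - u)) * (dr (Z k) u 0 - dr (Z' k) u 0))"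
      using hydro_solution_transport(1)[OF Z_sol k1 t r] hydro_solution_transport(1)[OF Z'_sol k1 t r]
      unfolding Sk right_diff_distrib by (rule set_integral_diff(1))
  next
    fix k :: nat and t r :: real
    assume k: "1 \<le> k" and t: "0 \<le> t" and r: "0 \<le> r"
    show "Z k t r - Z' k t r =
        (\<integral>u\<in>{0..t}. lam u * (flux G Z k u (t + r - u) - flux G Z' k u (t + r - u)) \<partial>lborel)
        - (\<integral>u\<in>{0..t}. (1 - G (t + r - u)) * (dr (Z (Suc k)) u 0 - dr (Z' (Suc k)) u 0) \<partial>lborel)"
      using hydro_solution_transport[OF Z_sol k t r] hydro_solution_transport[OF Z'_sol k t r]
      unfolding right_diff_distrib[of "lam _"] right_diff_distrib[of "1 - G _"] by simp
    show "\<bar>Z k t r - Z' k t r\<bar> \<le> 2"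
      using Z1[OF k t r] Z'1[OF k t r] by simp
  next
    fix k :: nat and u s M :: real
    assume "1 \<le> k" "0 \<le> u" "0 \<le> s" "\<And>k r. 1 \<le> k \<Longrightarrow> 0 \<le> r \<Longrightarrow> \<bar>Z k u r - Z' k u r\<bar> \<le> M"
    then show "\<bar>flux G Z k u s - flux G Z' k u s\<bar> \<le> 8 * M"
      using G01[of s] by (intro flux_diff_le Z1 Z'1) auto
  qed (use g_nonneg g_total G_dens lam_loc_int lam_nonneg in auto)
  then show "Z l t r = Z' l t r" by simp
qed

end
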